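(* Let $n\ge 2$ be an integer and let $D_n$ be the dihedral group of order $2n$. Then the chromatic number of the co-maximal hypergraph of $D_n$ is $\chi(Co_{\mathcal{H}}(D_n))=2$.
   Context: For $n\ge 1$, $D_n=\langle a,b \mid a^n=e,\ b^2=e,\ bab^{-1}=a^{-1}\rangle$ is the dihedral group of order $2n$ (so $D_2$ is the Klein four-group). For a group $G$, let $S$ be the set of all non-trivial proper subgroups of $G$ (i.e. subgroups different from $\{e\}$ and $G$). For subgroups $H,K$, $HK=\{hk : h\in H, k\in K\}$. The co-maximal hypergraph $Co_{\mathcal{H}}(G)$ has vertex set $V=\{H\in S : HK=G \text{ for some } K\in S\}$, and a subset $E\subseteq V$ is a hyperedge if and only if (1) $HK=G$ for all distinct $H,K\in E$, and (2) no subset $E'\subseteq V$ properly containing $E$ satisfies (1). A proper vertex-coloring of a hypergraph $\mathcal{H}$ is an assignment of colors to its vertices such that no hyperedge has all its vertices of the same color. The chromatic number $\chi(\mathcal{H})$ is the minimum number of colors needed for a proper vertex-coloring. *)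

theory Defs
  imports "HOL-Algebra.Coset" "HOL-Library.Extended_Nat"
begin

text \<open>
  Group presentations. A word over the generators is a list of letters; the letter
  (x, True) stands for the generator x and (x, False) for its formal inverse.
  The argument R is a set of pairs (u, v), standing for the relations u = v.
\<close>

type_synonym 'g gword = "('g \<times> bool) list"

inductive pres_eq :: "('g gword \<times> 'g gword) set \<Rightarrow> 'g gword \<Rightarrow> 'g gword \<Rightarrow> bool"
  for R where
  refl: "pres_eq R u u"
| sym: "pres_eq R u v \<Longrightarrow> pres_eq R v u"
| trans: "pres_eq R u v \<Longrightarrow> pres_eq R v w \<Longrightarrow> pres_eq R u w"
| append: "pres_eq R u u' \<Longrightarrow> pres_eq R v v' \<Longrightarrow> pres_eq R (u @ v) (u' @ v')"
| cancel: "pres_eq R [(x, s), (x, \<not> s)] []"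
| relation: "(u, v) \<in> R \<Longrightarrow> pres_eq R u v"

definition pres_class :: "('g gword \<times> 'g gword) set \<Rightarrow> 'g gword \<Rightarrow> 'g gword set" where
  "pres_class R u = {v. pres_eq R u v}"

definition presented_group :: "('g gword \<times> 'g gword) set \<Rightarrow> 'g gword set monoid" where
  "presented_group R =
     \<lparr> carrier = range (pres_class R),
       monoid.mult = (\<lambda>X Y. \<Union>u\<in>X. \<Union>v\<in>Y. pres_class R (u @ v)),
       one = pres_class R [] \<rparr>"

lemma pres_class_eq_iff: "pres_class R u = pres_class R v \<longleftrightarrow> pres_eq R u v"
proof
  assume "pres_class R u = pres_class R v"
  then show "pres_eq R u v"
    unfolding pres_class_def using pres_eq.refl[of R v] by blast
next
  assume "pres_eq R u v"
  then show "pres_class R u = pres_class R v"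
    unfolding pres_class_def using pres_eq.trans pres_eq.sym by blast
qed

lemma presented_group_mult:
  "pres_class R u \<otimes>\<^bsub>presented_group R\<^esub> pres_class R v = pres_class R (u @ v)"
proof -
  have "pres_class R (u' @ v') = pres_class R (u @ v)"
    if "u' \<in> pres_class R u" "v' \<in> pres_class R v" for u' v'
    using that unfolding pres_class_eq_iff by (simp add: pres_class_def pres_eq.append pres_eq.sym)
  moreover have "u \<in> pres_class R u" "v \<in> pres_class R v"
    by (auto simp: pres_class_def intro: pres_eq.refl)
  ultimately have "(\<Union>u'\<in>pres_class R u. \<Union>v'\<in>pres_class R v. pres_class R (u' @ v')) = pres_class R (u @ v)"
    by blast
  then show ?thesis
    by (simp add: presented_group_def)
qed

lemma pres_left_inverse: "\<exists>v. pres_eq R (v @ u) []"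
proof (induction u)
  case Nil
  show ?case using pres_eq.refl[of R "[]"] by (intro exI[of _ "[]"]) simp
next
  case (Cons l u)
  obtain x s where l: "l = (x, s)" by fastforce
  obtain v where v: "pres_eq R (v @ u) []" using Cons by blast
  have "pres_eq R ([(x, \<not> s), (x, s)] @ u) ([] @ u)"
    using pres_eq.append[OF pres_eq.cancel[of R x "\<not> s"] pres_eq.refl[of R u]] by simp
  then have "pres_eq R (v @ ([(x, \<not> s), (x, s)] @ u)) (v @ u)"
    using pres_eq.append[OF pres_eq.refl[of R v]] by fastforce
  then have "pres_eq R ((v @ [(x, \<not> s)]) @ (l # u)) []"
    using v l pres_eq.trans[of R _ "v @ u"] by simp
  then show ?case by blast
qed

lemma group_presented_group: "group (presented_group R)"
proof (rule groupI)
  fix X assume "X \<in> carrier (presented_group R)"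
  then obtain u where u: "X = pres_class R u" by (auto simp: presented_group_def)
  obtain v where "pres_eq R (v @ u) []" using pres_left_inverse by blast
  then have "pres_class R v \<otimes>\<^bsub>presented_group R\<^esub> X = \<one>\<^bsub>presented_group R\<^esub>"
    by (simp add: u presented_group_mult pres_class_eq_iff) (simp add: presented_group_def pres_class_eq_iff)
  then show "\<exists>Y\<in>carrier (presented_group R). Y \<otimes>\<^bsub>presented_group R\<^esub> X = \<one>\<^bsub>presented_group R\<^esub>"
    by (auto simp: presented_group_def)
next
  have c: "carrier (presented_group R) = range (pres_class R)"
    and o: "\<one>\<^bsub>presented_group R\<^esub> = pres_class R []"
    by (simp_all add: presented_group_def)
  show "\<one>\<^bsub>presented_group R\<^esub> \<in> carrier (presented_group R)" by (simp add: c o)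
  fix X assume X: "X \<in> carrier (presented_group R)"
  then show "\<one>\<^bsub>presented_group R\<^esub> \<otimes>\<^bsub>presented_group R\<^esub> X = X"
    by (auto simp: c o presented_group_mult)
  fix Y assume Y: "Y \<in> carrier (presented_group R)"
  show "X \<otimes>\<^bsub>presented_group R\<^esub> Y \<in> carrier (presented_group R)"
    using X Y by (auto simp: c presented_group_mult)
  fix Z assume Z: "Z \<in> carrier (presented_group R)"
  show "X \<otimes>\<^bsub>presented_group R\<^esub> Y \<otimes>\<^bsub>presented_group R\<^esub> Z
      = X \<otimes>\<^bsub>presented_group R\<^esub> (Y \<otimes>\<^bsub>presented_group R\<^esub> Z)"
    using X Y Z by (auto simp: c presented_group_mult)
qed

datatype dihedral_gen = gen_a | gen_b

text \<open>The group \<open>\<langle>a, b | a^n = e, b^2 = e, b a b^-1 = a^-1\<rangle>\<close>.\<close>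

definition dihedral_group :: "nat \<Rightarrow> dihedral_gen gword set monoid" where
  "dihedral_group n = presented_group
     {(replicate n (gen_a, True), []),
      (replicate 2 (gen_b, True), []),
      ([(gen_b, True), (gen_a, True), (gen_b, False)], [(gen_a, False)])}"

text \<open>A hypergraph is a pair consisting of its vertex set and its set of hyperedges.\<close>

type_synonym 'v hypergraph = "'v set \<times> 'v set set"

definition proper_colouring :: "'v hypergraph \<Rightarrow> ('v \<Rightarrow> 'c) \<Rightarrow> bool" where
  "proper_colouring \<H> c \<longleftrightarrow> (\<forall>E\<in>snd \<H>. \<not> (\<exists>col. \<forall>v\<in>E. c v = col))"

text \<open>The value is \<open>\<infinity>\<close> if no proper colouring with finitely many colours exists.\<close>

definition chromatic_number :: "'v hypergraph \<Rightarrow> enat" where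
  "chromatic_number \<H> =
     Inf {enat k | k. \<exists>c :: 'v \<Rightarrow> nat. c ` fst \<H> \<subseteq> {..<k} \<and> proper_colouring \<H> c}"

definition nontrivial_proper_subgroups :: "('a, 'b) monoid_scheme \<Rightarrow> 'a set set" where
  "nontrivial_proper_subgroups G = {H. subgroup H G \<and> H \<noteq> {\<one>\<^bsub>G\<^esub>} \<and> H \<noteq> carrier G}"

definition comaximal_vertices :: "('a, 'b) monoid_scheme \<Rightarrow> 'a set set" where
  "comaximal_vertices G =
     {H \<in> nontrivial_proper_subgroups G.
        \<exists>K\<in>nontrivial_proper_subgroups G. H <#>\<^bsub>G\<^esub> K = carrier G}"

definition pairwise_comaximal :: "('a, 'b) monoid_scheme \<Rightarrow> 'a set set \<Rightarrow> bool" where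
  "pairwise_comaximal G E \<longleftrightarrow> (\<forall>H\<in>E. \<forall>K\<in>E. H \<noteq> K \<longrightarrow> H <#>\<^bsub>G\<^esub> K = carrier G)"

definition comaximal_hypergraph :: "('a, 'b) monoid_scheme \<Rightarrow> 'a set hypergraph" where
  "comaximal_hypergraph G =
     (comaximal_vertices G,
      {E. E \<subseteq> comaximal_vertices G \<and> pairwise_comaximal G E \<and>
          \<not> (\<exists>E'. E' \<subseteq> comaximal_vertices G \<and> E \<subset> E' \<and> pairwise_comaximal G E')})"

end

(* The rotation subgroup N has index 2, so N H = G for every subgroup H not contained in N.
   Colour a subgroup by whether it lies in N. Two subgroups of N are never comaximal, so a
   monochromatic hyperedge inside N would have at most one vertex, and such a set is never
   maximal; a monochromatic hyperedge outside N could be enlarged by N itself. One colour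
   does not suffice because maximal pairwise comaximal sets exist by Zorn's lemma. *)
theory Submission
  imports Defs "HOL-Number_Theory.Cong"
begin

section \<open>Groups with a subgroup comaximal to everything outside it\<close>

text \<open>Inversion maps \<open>H <#> K\<close> onto \<open>K <#> H\<close> and maps the whole
  group onto itself. This is needed because the definition of a vertex fixes one order of the
  factors, while \<open>pairwise_comaximal\<close> asks for both.\<close>

lemma (in group) set_mult_eq_carrier_commute:
  assumes H: "subgroup H G" and K: "subgroup K G" and HK: "H <#> K = carrier G"
  shows "K <#> H = carrier G"
proof
  show "K <#> H \<subseteq> carrier G"
    using H K by (simp add: set_mult_closed subgroup.subset)
  show "carrier G \<subseteq> K <#> H"
  proof
    fix g assume g: "g \<in> carrier G"
    then have "inv g \<in> H <#> K" using HK by simp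
    then obtain h k where hk: "h \<in> H" "k \<in> K" "inv g = h \<otimes> k"
      unfolding set_mult_def by blast
    then have "h \<in> carrier G" "k \<in> carrier G"
      using H K by (auto dest: subgroup.mem_carrier)
    then have "g = inv k \<otimes> inv h"
      using hk(3) g by (metis inv_inv inv_mult_group)
    then show "g \<in> K <#> H"
      using hk H K unfolding set_mult_def by (blast intro: subgroup.m_inv_closed)
  qed
qed

text \<open>The hypothesis \<open>index\<close> expresses index at most 2 without cosets. For a
  fixed \<open>h\<close> in \<open>H\<close> outside \<open>N\<close>, every \<open>g\<close>
  outside \<open>N\<close> factors as \<open>(g \<otimes> inv h) \<otimes> h\<close>, whose first
  factor lies in \<open>N\<close>.\<close>

lemma (in group) index_2_set_mult:
  assumes N: "subgroup N G" and H: "subgroup H G" and nsub: "\<not> H \<subseteq> N"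
    and index: "\<And>x y. x \<in> carrier G - N \<Longrightarrow> y \<in> carrier G - N \<Longrightarrow> x \<otimes> y \<in> N"
  shows "N <#> H = carrier G"
proof
  show "N <#> H \<subseteq> carrier G"
    using H N by (simp add: set_mult_closed subgroup.subset)
  obtain h where h: "h \<in> H" "h \<notin> N" using nsub by blast
  have hG: "h \<in> carrier G" using h(1) H by (auto dest: subgroup.mem_carrier)
  have ih: "inv h \<in> carrier G - N"
    using h hG N by (metis DiffI inv_closed inv_inv subgroup.m_inv_closed)
  show "carrier G \<subseteq> N <#> H"
  proof
    fix g assume g: "g \<in> carrier G"
    show "g \<in> N <#> H"
    proof (cases "g \<in> N")
      case True
      have "g = g \<otimes> \<one>" using g by simp
      then show ?thesis
        using True subgroup.one_closed[OF H] unfolding set_mult_def by blast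
    next
      case False
      have "g = (g \<otimes> inv h) \<otimes> h" using g hG by (simp add: m_assoc)
      moreover have "g \<otimes> inv h \<in> N" using False g ih by (intro index) auto
      ultimately show ?thesis using h(1) unfolding set_mult_def by blast
    qed
  qed
qed

lemma (in group) comaximal_verticesI:
  assumes "H \<in> nontrivial_proper_subgroups G" "K \<in> nontrivial_proper_subgroups G"
    and "H <#> K = carrier G"
  shows "H \<in> comaximal_vertices G" "K \<in> comaximal_vertices G"
proof -
  have "K <#> H = carrier G"
    using assms by (intro set_mult_eq_carrier_commute[of H K])
      (simp_all add: nontrivial_proper_subgroups_def)
  then show "H \<in> comaximal_vertices G" "K \<in> comaximal_vertices G"
    using assms unfolding comaximal_vertices_def by blast+
qed

text \<open>A vertex \<open>H\<close> has a partner \<open>K\<close>, and \<open>K\<close> differs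
  from \<open>H\<close> because \<open>H <#> H = H\<close> is proper. So \<open>{H, K}\<close>
  strictly extends both \<open>{}\<close> and \<open>{H}\<close>, and neither is maximal.\<close>

lemma (in group) comaximal_hyperedge_not_singleton:
  assumes E: "E \<in> snd (comaximal_hypergraph G)" and H: "H \<in> comaximal_vertices G"
  shows "\<not> E \<subseteq> {H}"
proof
  assume sub: "E \<subseteq> {H}"
  obtain K where HS: "H \<in> nontrivial_proper_subgroups G"
    and KS: "K \<in> nontrivial_proper_subgroups G" and HK: "H <#> K = carrier G"
    using H by (auto simp: comaximal_vertices_def)
  have KH: "K <#> H = carrier G"
    using HS KS HK by (intro set_mult_eq_carrier_commute[of H K])
      (simp_all add: nontrivial_proper_subgroups_def)
  have "H <#> H = H" "H \<noteq> carrier G"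
    using HS by (auto simp: nontrivial_proper_subgroups_def subgroup_mult_id)
  then have "K \<noteq> H" using HK by auto
  then have "E \<subset> {H, K}" using sub by blast
  moreover have "{H, K} \<subseteq> comaximal_vertices G"
    using comaximal_verticesI[OF HS KS HK] by simp
  moreover have "pairwise_comaximal G {H, K}"
    using HK KH by (auto simp: pairwise_comaximal_def)
  ultimately show False
    using E by (auto simp: comaximal_hypergraph_def)
qed

text \<open>This serves the lower bound: if there were no hyperedge, every colouring would be
  proper. Zorn's lemma applies because any two members of the union of a chain already lie in one
  member of the chain.\<close>

lemma comaximal_hyperedge_exists: "\<exists>E. E \<in> snd (comaximal_hypergraph G)"
proof -
  let ?A = "{E. E \<subseteq> comaximal_vertices G \<and> pairwise_comaximal G E}"
  have "\<exists>M\<in>?A. \<forall>X\<in>?A. M \<subseteq> X \<longrightarrow> X = M"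
  proof (rule subset_Zorn')
    fix C assume C: "subset.chain ?A C"
    have "H <#>\<^bsub>G\<^esub> K = carrier G"
      if "H \<in> \<Union>C" "K \<in> \<Union>C" "H \<noteq> K" for H K
    proof -
      obtain X Y where XY: "X \<in> C" "Y \<in> C" "H \<in> X" "K \<in> Y" using \<open>H \<in> \<Union>C\<close> \<open>K \<in> \<Union>C\<close> by blast
      then have "X \<subseteq> Y \<or> Y \<subseteq> X" "pairwise_comaximal G X" "pairwise_comaximal G Y"
        using C by (auto simp: subset_chain_def)
      then show ?thesis using XY \<open>H \<noteq> K\<close> unfolding pairwise_comaximal_def by blast
    qed
    moreover have "\<Union>C \<subseteq> comaximal_vertices G" using C by (auto simp: subset_chain_def)
    ultimately show "\<Union>C \<in> ?A" unfolding pairwise_comaximal_def by blast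
  qed
  then show ?thesis by (simp add: comaximal_hypergraph_def) blast
qed

text \<open>The subgroup \<open>H\<close> serves to make \<open>N\<close> a vertex: by
  \<open>comax\<close> it is a partner of \<open>N\<close>.\<close>

lemma (in group) chromatic_number_comaximal_eq_2:
  assumes N: "N \<in> nontrivial_proper_subgroups G"
    and H: "H \<in> nontrivial_proper_subgroups G" "\<not> H \<subseteq> N"
    and comax: "\<And>K. subgroup K G \<Longrightarrow> \<not> K \<subseteq> N \<Longrightarrow> N <#> K = carrier G"
  shows "chromatic_number (comaximal_hypergraph G) = 2"
proof (rule antisym)
  have sN: "subgroup N G" "N \<noteq> carrier G"
    using N by (auto simp: nontrivial_proper_subgroups_def)
  have "N <#> H = carrier G"
    using H by (intro comax) (auto simp: nontrivial_proper_subgroups_def)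
  then have NV: "N \<in> comaximal_vertices G"
    using N H comaximal_verticesI by blast
  define c :: "'a set \<Rightarrow> nat" where "c K = (if K \<subseteq> N then 0 else 1)" for K
  have "proper_colouring (comaximal_hypergraph G) c"
    unfolding proper_colouring_def
  proof (intro ballI notI)
    fix E assume E: "E \<in> snd (comaximal_hypergraph G)" and "\<exists>col. \<forall>v\<in>E. c v = col"
    then have "(\<forall>K\<in>E. K \<subseteq> N) \<or> (\<forall>K\<in>E. \<not> K \<subseteq> N)"
      unfolding c_def by (metis zero_neq_one)
    then show False
    proof
      assume inN: "\<forall>K\<in>E. K \<subseteq> N"
      have "K = L" if "K \<in> E" "L \<in> E" for K L
      proof (rule ccontr)
        assume "K \<noteq> L"
        then have "K <#> L = carrier G"
          using E that by (auto simp: comaximal_hypergraph_def pairwise_comaximal_def)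
        \<comment> \<open>Products of elements of \<open>N\<close> stay in \<open>N\<close>, which
          is proper.\<close>
        moreover have "K <#> L \<subseteq> N <#> N" using inN that by (simp add: mono_set_mult)
        ultimately show False
          using sN subgroup_mult_id[OF sN(1)] subgroup.subset by blast
      qed
      moreover have "E \<subseteq> comaximal_vertices G"
        using E by (simp add: comaximal_hypergraph_def)
      \<comment> \<open>For empty \<open>E\<close> the vertex \<open>N\<close> itself is the
        witness.\<close>
      ultimately have "\<exists>K\<in>comaximal_vertices G. E \<subseteq> {K}"
        using NV by (cases "E = {}") blast+
      then show False using comaximal_hyperedge_not_singleton[OF E] by blast
    next
      assume outN: "\<forall>K\<in>E. \<not> K \<subseteq> N"
      have EV: "E \<subseteq> comaximal_vertices G" and pE: "pairwise_comaximal G E"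
        using E by (auto simp: comaximal_hypergraph_def)
      have "N <#> K = carrier G" "K <#> N = carrier G" if "K \<in> E" for K
      proof -
        have sK: "subgroup K G"
          using that EV by (auto simp: comaximal_vertices_def nontrivial_proper_subgroups_def)
        show "N <#> K = carrier G" using comax sK outN that by blast
        then show "K <#> N = carrier G" by (rule set_mult_eq_carrier_commute[OF sN(1) sK])
      qed
      then have "pairwise_comaximal G (insert N E)"
        using pE by (auto simp: pairwise_comaximal_def)
      \<comment> \<open>The extension is strict: \<open>N\<close> is contained in itself, so it
        cannot be a member of \<open>E\<close>.\<close>
      moreover have "E \<subset> insert N E" using outN by blast
      ultimately show False
        using E NV EV by (auto simp: comaximal_hypergraph_def)
    qed
  qed
  moreover have "c ` fst (comaximal_hypergraph G) \<subseteq> {..<2}" by (auto simp: c_def)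
  ultimately show "chromatic_number (comaximal_hypergraph G) \<le> 2"
    unfolding chromatic_number_def numeral_eq_enat by (intro Inf_lower) blast
next
  obtain E where E: "E \<in> snd (comaximal_hypergraph G)"
    using comaximal_hyperedge_exists by blast
  show "2 \<le> chromatic_number (comaximal_hypergraph G)"
    unfolding chromatic_number_def
  proof (rule Inf_greatest, clarify)
    fix k and c :: "'a set \<Rightarrow> nat"
    assume c: "c ` fst (comaximal_hypergraph G) \<subseteq> {..<k}"
      "proper_colouring (comaximal_hypergraph G) c"
    show "2 \<le> enat k"
    proof (rule ccontr)
      assume "\<not> 2 \<le> enat k"
      then have "k \<le> 1" by (simp add: numeral_eq_enat)
      \<comment> \<open>For \<open>k = 0\<close> there can be no vertices, so \<open>E\<close> is
        empty and the claim is vacuous.\<close>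
      then have "\<forall>v\<in>E. c v = 0"
        using c(1) E by (fastforce simp: comaximal_hypergraph_def)
      then show False using c(2) E unfolding proper_colouring_def by blast
    qed
  qed
qed

section \<open>The dihedral group\<close>

abbreviation dihedral_relations :: "nat \<Rightarrow> (dihedral_gen gword \<times> dihedral_gen gword) set" where
  "dihedral_relations n \<equiv>
     {(replicate n (gen_a, True), []),
      (replicate 2 (gen_b, True), []),
      ([(gen_b, True), (gen_a, True), (gen_b, False)], [(gen_a, False)])}"

text \<open>This is the homomorphism to Z/2 with a mapped to 0 and b to 1. Both signs of b count
  alike because 1 = -1 in Z/2.\<close>

definition reflection_word :: "dihedral_gen gword \<Rightarrow> bool" where
  "reflection_word u \<longleftrightarrow> odd (length (filter (\<lambda>l. fst l = gen_b) u))"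

lemma reflection_word_append:
  "reflection_word (u @ v) \<longleftrightarrow> reflection_word u \<noteq> reflection_word v"
  by (auto simp: reflection_word_def)

text \<open>Every defining relation, and every cancellation, changes the number of b-letters by 0 or
  2.\<close>

lemma reflection_word_cong:
  "pres_eq (dihedral_relations n) u v \<Longrightarrow> reflection_word u \<longleftrightarrow> reflection_word v"
proof (induction rule: pres_eq.induct)
  case (append u u' v v')
  then show ?case by (simp add: reflection_word_append)
next
  case (cancel x s)
  show ?case by (cases "x = gen_b") (simp_all add: reflection_word_def)
next
  case (relation u v)
  then show ?case by (auto simp: reflection_word_def)
qed simp_all

text \<open>The action of \<open>D\<^sub>n\<close> on \<open>\<int>/n\<int>\<close>, lifted to \<open>\<int>\<close>.\<close>

fun letter_act :: "dihedral_gen \<times> bool \<Rightarrow> int \<Rightarrow> int" where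
  "letter_act (gen_a, s) x = (if s then x + 1 else x - 1)"
| "letter_act (gen_b, s) x = - x"

lemma letter_act_cong:
  "[x = y] (mod m) \<Longrightarrow> [letter_act l x = letter_act l y] (mod m)"
proof (cases l)
  case (Pair g s)
  assume "[x = y] (mod m)"
  then show ?thesis
    unfolding Pair by (cases g) (auto intro: cong_add cong_diff simp: cong_minus_minus_iff)
qed

lemma foldr_letter_act_cong:
  "[x = y] (mod m) \<Longrightarrow> [foldr letter_act u x = foldr letter_act u y] (mod m)"
  by (induction u) (auto intro: letter_act_cong)

lemma foldr_letter_act_replicate:
  "foldr letter_act (replicate k (gen_a, True)) x = x + int k"
  by (induction k) (auto simp del: foldr_replicate)

text \<open>Concatenation of words becomes composition of maps, and the relations hold modulo
  \<open>n\<close>: a^n translates by \<open>n\<close>, b^2 is the identity, and b a b^-1 sends x to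
  -(-x + 1) = x - 1.\<close>

lemma foldr_letter_act_pres_eq:
  "pres_eq (dihedral_relations n) u v \<Longrightarrow>
     [foldr letter_act u x = foldr letter_act v x] (mod int n)"
proof (induction arbitrary: x rule: pres_eq.induct)
  case (sym u v)
  then show ?case by (blast intro: cong_sym)
next
  case (trans u v w)
  then show ?case by (blast intro: cong_trans)
next
  case (append u u' v v')
  show ?case
    \<comment> \<open>First \<open>v\<close> is replaced by \<open>v'\<close> under the action of
      \<open>u\<close>, then \<open>u\<close> by \<open>u'\<close> at the point already moved by
      \<open>v'\<close>; hence the induction over arbitrary \<open>x\<close>.\<close>
    using cong_trans[OF foldr_letter_act_cong[OF append.IH(2)] append.IH(1)] by simp
next
  case (cancel g s)
  then show ?case by (cases g) auto
next
  case (relation u v)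
  then show ?case
    by (auto simp: foldr_letter_act_replicate numeral_2_eq_2 cong_iff_dvd_diff simp del: foldr_replicate)
qed auto

text \<open>The generator a moves 0 to 1, and these are distinct modulo \<open>n\<close> once
  \<open>n \<ge> 2\<close>.\<close>

lemma generator_a_nontrivial:
  assumes "n \<ge> 2"
  shows "\<not> pres_eq (dihedral_relations n) [(gen_a, True)] []"
proof
  assume "pres_eq (dihedral_relations n) [(gen_a, True)] []"
  from foldr_letter_act_pres_eq[OF this, of 0] have "int n dvd 1"
    by (simp add: cong_iff_dvd_diff)
  then show False using assms by simp
qed

theorem theorem2p7:
  fixes n :: nat
  assumes "n \<ge> 2"
  shows "chromatic_number (comaximal_hypergraph (dihedral_group n)) = 2"
proof -
  define G where "G = dihedral_group n"
  define cl where "cl = pres_class (dihedral_relations n)"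
  \<comment> \<open>\<open>N\<close> is the kernel of the parity map, the rotation subgroup;
    \<open>H\<close> is generated by the reflection b and will be a partner of
    \<open>N\<close>.\<close>
  define N where "N = cl ` {u. \<not> reflection_word u}"
  define H where "H = {cl [], cl [(gen_b, True)]}"
  interpret group G
    unfolding G_def dihedral_group_def by (rule group_presented_group)
  have carrier: "carrier G = range cl" and one: "\<one>\<^bsub>G\<^esub> = cl []"
    by (simp_all add: G_def cl_def dihedral_group_def presented_group_def)
  have mult: "cl u \<otimes>\<^bsub>G\<^esub> cl v = cl (u @ v)" for u v
    by (simp add: G_def cl_def dihedral_group_def presented_group_mult)
  have cl_eq: "cl u = cl v \<longleftrightarrow> pres_eq (dihedral_relations n) u v" for u v
    unfolding cl_def by (rule pres_class_eq_iff)
  \<comment> \<open>Parity is constant on classes, so membership can be tested on any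
    representative.\<close>
  have N_iff: "cl u \<in> N \<longleftrightarrow> \<not> reflection_word u" for u
    unfolding N_def using cl_eq reflection_word_cong by blast
  have refl_Nil: "\<not> reflection_word []" and refl_a: "\<not> reflection_word [(gen_a, True)]"
    and refl_b: "reflection_word [(gen_b, True)]"
    by (simp_all add: reflection_word_def)
  have a_neq: "cl [(gen_a, True)] \<noteq> cl []"
    using generator_a_nontrivial[OF assms] by (simp add: cl_eq)
  have b_neq: "cl [(gen_b, True)] \<noteq> cl u" if "\<not> reflection_word u" for u
    using that refl_b N_iff by metis
  have b_sq: "cl [(gen_b, True), (gen_b, True)] = cl []"
    unfolding cl_eq by (rule pres_eq.relation) (simp add: numeral_2_eq_2)
  have sN: "subgroup N G"
  proof (rule subgroupI)
    show "N \<subseteq> carrier G" by (auto simp: N_def carrier)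
    show "N \<noteq> {}" using N_iff refl_Nil by blast
    show "x \<otimes>\<^bsub>G\<^esub> y \<in> N" if "x \<in> N" "y \<in> N" for x y
      using that N_iff unfolding N_def by (auto simp: mult reflection_word_append)
    show "inv\<^bsub>G\<^esub> x \<in> N" if "x \<in> N" for x
    proof -
      obtain u where u: "x = cl u" "\<not> reflection_word u" using \<open>x \<in> N\<close> by (auto simp: N_def)
      obtain v where v: "inv\<^bsub>G\<^esub> x = cl v"
        using u carrier inv_closed[of x] by auto
      have "cl (u @ v) = cl []"
        using u v carrier r_inv[of x] by (simp add: mult one)
      \<comment> \<open>The word \<open>u @ v\<close> represents the identity and so has even
        parity; as \<open>u\<close> is even, so is \<open>v\<close>.\<close>
      then show ?thesis
        using u v N_iff refl_Nil reflection_word_append by metis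
    qed
  qed
  have sH: "subgroup H G"
  proof (rule subgroupI)
    show "H \<subseteq> carrier G" "H \<noteq> {}" by (auto simp: H_def carrier)
    show "x \<otimes>\<^bsub>G\<^esub> y \<in> H" if xy: "x \<in> H" "y \<in> H" for x y
    proof -
      obtain u v where "x = cl u" "u = [] \<or> u = [(gen_b, True)]"
        and "y = cl v" "v = [] \<or> v = [(gen_b, True)]"
        using xy unfolding H_def by blast
      then have "x \<otimes>\<^bsub>G\<^esub> y \<in> {cl [], cl [(gen_b, True)], cl [(gen_b, True), (gen_b, True)]}"
        by (elim disjE) (simp_all add: mult)
      then show ?thesis unfolding H_def b_sq by blast
    qed
    show "inv\<^bsub>G\<^esub> x \<in> H" if x: "x \<in> H" for x
    proof -
      obtain u where u: "x = cl u" "u = [] \<or> u = [(gen_b, True)]"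
        using x unfolding H_def by blast
      then have "x \<otimes>\<^bsub>G\<^esub> x = \<one>\<^bsub>G\<^esub>"
        by (elim disjE) (simp_all add: mult one b_sq)
      moreover have "x \<in> carrier G" using u by (simp add: carrier)
      ultimately have "inv\<^bsub>G\<^esub> x = x" by (simp add: inv_equality)
      then show ?thesis using x by simp
    qed
  qed
  have "N \<noteq> {\<one>\<^bsub>G\<^esub>}"
    using a_neq N_iff refl_a one by blast
  moreover have "N \<noteq> carrier G" using N_iff refl_b carrier by blast
  moreover have "H \<noteq> {\<one>\<^bsub>G\<^esub>}" using b_neq[OF refl_Nil] by (auto simp: H_def one)
  \<comment> \<open>The class of a differs from the identity by the action on the integers modulo
    \<open>n\<close>, and from the class of b by parity; this makes \<open>H\<close> proper.\<close>
  moreover have "cl [(gen_a, True)] \<notin> H" using a_neq b_neq[OF refl_a] by (auto simp: H_def)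
  then have "H \<noteq> carrier G" using carrier by blast
  moreover have "\<not> H \<subseteq> N" using N_iff refl_b by (auto simp: H_def)
  \<comment> \<open>The index condition holds because two words of odd parity concatenate to one of
    even parity.\<close>
  moreover have "N <#>\<^bsub>G\<^esub> K = carrier G" if "subgroup K G" "\<not> K \<subseteq> N" for K
    using sN that
    by (rule index_2_set_mult) (auto simp: carrier mult N_iff reflection_word_append)
  ultimately show ?thesis
    using sN sH chromatic_number_comaximal_eq_2[of N H]
    by (simp add: nontrivial_proper_subgroups_def G_def)
qed

end
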